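(* The following two statements are equivalent: (i) For any two Gallai-Ramsey configurations $K_1$ and $K_2$, the Cartesian product $K_1\ast K_2$ is Gallai-Ramsey. (ii) Every Gallai-Ramsey configuration is Ramsey.
   Context: A configuration is a finite nonempty set of points in some Euclidean space $\mathbb{E}^m$. For $K_1\subset\mathbb{E}^{m_1}$, $K_2\subset\mathbb{E}^{m_2}$, the Cartesian product is $K_1\ast K_2=\{(x_1,\dots,x_{m_1},y_1,\dots,y_{m_2}):(x_i)\in K_1,(y_j)\in K_2\}\subset\mathbb{E}^{m_1+m_2}$. A configuration $K$ is Ramsey if for every positive integer $r$ there is $d$ such that every coloring of $\mathbb{E}^d$ with $r$ colors contains a monochromatic configuration congruent to $K$. A configuration $K$ is Gallai-Ramsey if for every positive integer $r$ there is $d$ such that every coloring of $\mathbb{E}^d$ with $r$ colors contains a configuration congruent to $K$ that is either monochromatic (all points the same color) or rainbow (all points pairwise distinct colors). *)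

theory Defs
  imports "HOL-Analysis.L2_Norm"
begin

text \<open>
  The dimension is quantified inside the statements below, so a point of Euclidean \<open>d\<close>-space
  is represented by the list of its \<open>d\<close> coordinates.
\<close>

definition euclid :: "nat \<Rightarrow> real list set" where
  "euclid d = {x. length x = d}"

text \<open>Only meaningful for two points of the same space, i.e. lists of equal length.\<close>

definition euclid_dist :: "real list \<Rightarrow> real list \<Rightarrow> real" where
  "euclid_dist x y = L2_set (\<lambda>i. x ! i - y ! i) {..<length x}"

definition configuration :: "real list set \<Rightarrow> bool" where
  "configuration K \<longleftrightarrow> finite K \<and> K \<noteq> {} \<and> (\<exists>m. K \<subseteq> euclid m)"

text \<open>The two sets may lie in Euclidean spaces of different dimensions.\<close>

definition congruent_conf :: "real list set \<Rightarrow> real list set \<Rightarrow> bool" where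
  "congruent_conf K L \<longleftrightarrow>
     (\<exists>f. bij_betw f K L \<and> (\<forall>x\<in>K. \<forall>y\<in>K. euclid_dist (f x) (f y) = euclid_dist x y))"

definition cart_prod :: "real list set \<Rightarrow> real list set \<Rightarrow> real list set" where
  "cart_prod K\<^sub>1 K\<^sub>2 = {x @ y | x y. x \<in> K\<^sub>1 \<and> y \<in> K\<^sub>2}"

definition coloring :: "nat \<Rightarrow> nat \<Rightarrow> (real list \<Rightarrow> nat) \<Rightarrow> bool" where
  "coloring d r c \<longleftrightarrow> (\<forall>x\<in>euclid d. c x < r)"

definition monochromatic :: "(real list \<Rightarrow> nat) \<Rightarrow> real list set \<Rightarrow> bool" where
  "monochromatic c K \<longleftrightarrow> (\<forall>x\<in>K. \<forall>y\<in>K. c x = c y)"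

definition rainbow :: "(real list \<Rightarrow> nat) \<Rightarrow> real list set \<Rightarrow> bool" where
  "rainbow c K \<longleftrightarrow> (\<forall>x\<in>K. \<forall>y\<in>K. x \<noteq> y \<longrightarrow> c x \<noteq> c y)"

definition ramsey :: "real list set \<Rightarrow> bool" where
  "ramsey K \<longleftrightarrow> configuration K \<and>
     (\<forall>r\<ge>1. \<exists>d. \<forall>c. coloring d r c \<longrightarrow>
        (\<exists>L\<subseteq>euclid d. congruent_conf K L \<and> monochromatic c L))"

definition gallai_ramsey :: "real list set \<Rightarrow> bool" where
  "gallai_ramsey K \<longleftrightarrow> configuration K \<and>
     (\<forall>r\<ge>1. \<exists>d. \<forall>c. coloring d r c \<longrightarrow>
        (\<exists>L\<subseteq>euclid d. congruent_conf K L \<and> (monochromatic c L \<or> rainbow c L)))"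

end

theory Submission
  imports Defs "HOL-Analysis.Function_Topology"
begin

text \<open>
  If products preserve the Gallai-Ramsey property and \<open>K\<close> is Gallai-Ramsey with at least two
  points, then for every \<open>r\<close> some power of \<open>K\<close> is Gallai-Ramsey with more than \<open>r\<close> points. It has
  no rainbow copy in an \<open>r\<close>-coloring, so it has a monochromatic one, and a slice of that copy is a
  monochromatic copy of \<open>K\<close>.

  Conversely it suffices that products of Ramsey configurations are Ramsey. By compactness, some
  finite set \<open>T\<close> of points already contains a monochromatic copy of \<open>K\<^sub>1\<close> in each of its
  \<open>r\<close>-colorings. Given a coloring \<open>c\<close> of pairs, color the points \<open>y\<close> of a second space by the
  functions \<open>x \<mapsto> c (x, y)\<close> on \<open>T\<close>. These are finitely many colors, so there is a copy of \<open>K\<^sub>2\<close> on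
  which \<open>c (x, y)\<close> depends on \<open>x \<in> T\<close> only.
\<close>

section \<open>Compactness for colorings with finitely many colors\<close>

lemma openin_product_discrete_if_finitely_determined:
  assumes "finite E" and S: "S \<subseteq> (\<Pi>\<^sub>E x\<in>V. C x)"
    and determined: "\<And>c c'. c \<in> S \<Longrightarrow> c' \<in> (\<Pi>\<^sub>E x\<in>V. C x) \<Longrightarrow> (\<forall>x\<in>E. c' x = c x) \<Longrightarrow> c' \<in> S"
  shows "openin (product_topology (\<lambda>x. discrete_topology (C x)) V) S"
proof (subst openin_subopen, intro ballI)
  fix c
  assume c: "c \<in> S"
  then have c_PiE: "c \<in> (\<Pi>\<^sub>E x\<in>V. C x)"
    using S by blast
  define B where "B = (\<Pi>\<^sub>E x\<in>V. if x \<in> E \<inter> V then {c x} else C x)"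
  have "openin (product_topology (\<lambda>x. discrete_topology (C x)) V) B"
    unfolding B_def
  proof (rule product_topology_basis)
    show "finite {x. (if x \<in> E \<inter> V then {c x} else C x) \<noteq> topspace (discrete_topology (C x))}"
      using \<open>finite E\<close> by (rule rev_finite_subset) auto
  qed (use c_PiE in \<open>auto simp: PiE_iff\<close>)
  moreover have "c \<in> B"
    using c_PiE by (auto simp: B_def PiE_iff)
  moreover have "B \<subseteq> S"
  proof
    fix c'
    assume c': "c' \<in> B"
    have c'_PiE: "c' \<in> (\<Pi>\<^sub>E x\<in>V. C x)"
      using c' c_PiE by (auto simp: B_def PiE_iff split: if_splits)
    moreover have "c' x = c x" if "x \<in> E" for x
      using that c' PiE_arb[OF c_PiE] PiE_arb[OF c'_PiE]
      by (cases "x \<in> V") (auto simp: B_def PiE_iff)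
    ultimately show "c' \<in> S"
      using determined[OF c] by blast
  qed
  ultimately show "\<exists>B. openin (product_topology (\<lambda>x. discrete_topology (C x)) V) B \<and> c \<in> B \<and> B \<subseteq> S"
    by blast
qed

lemma finite_subfamily_constant_on:
  assumes "finite C" and finite_members: "\<forall>E\<in>\<E>. finite E" and "\<E> \<subseteq> Pow V"
    and ex_constant: "\<forall>c \<in> V \<rightarrow> C. \<exists>E\<in>\<E>. c constant_on E"
  obtains \<F> where "finite \<F>" "\<F> \<subseteq> \<E>" "\<forall>c \<in> V \<rightarrow> C. \<exists>E\<in>\<F>. c constant_on E"
proof -
  define X where "X = product_topology (\<lambda>_. discrete_topology C) V"
  define U where "U E = {c \<in> V \<rightarrow>\<^sub>E C. c constant_on E}" for E
  have topspace_X: "topspace X = V \<rightarrow>\<^sub>E C"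
    by (simp add: X_def)
  have "compact_space X"
    using \<open>finite C\<close>
    by (simp add: X_def compact_space_product_topology compact_space_discrete_topology)
  moreover have "\<forall>W\<in>U ` \<E>. openin X W"
  proof (intro ballI, elim imageE)
    fix W E
    assume "W = U E" "E \<in> \<E>"
    then show "openin X W"
      unfolding X_def
      by (intro openin_product_discrete_if_finitely_determined[of E])
        (auto simp: U_def constant_on_def finite_members)
  qed
  moreover have "topspace X \<subseteq> \<Union> (U ` \<E>)"
    using ex_constant by (fastforce simp: topspace_X U_def)
  ultimately obtain \<W> where "finite \<W>" "\<W> \<subseteq> U ` \<E>" and "topspace X \<subseteq> \<Union>\<W>"
    unfolding compact_space_alt by meson
  then obtain \<F> where \<F>: "finite \<F>" "\<F> \<subseteq> \<E>" and cover: "topspace X \<subseteq> \<Union> (U ` \<F>)"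
    by (metis finite_subset_image)
  have "\<exists>E\<in>\<F>. c constant_on E" if "c \<in> V \<rightarrow> C" for c
  proof -
    have "restrict c V \<in> topspace X"
      using that by (auto simp: topspace_X)
    then obtain E where E: "E \<in> \<F>" "restrict c V constant_on E"
      using cover by (auto simp: U_def)
    moreover have "E \<subseteq> V"
      using E(1) \<F>(2) \<open>\<E> \<subseteq> Pow V\<close> by blast
    ultimately show ?thesis
      by (intro bexI[of _ E]) (auto simp: constant_on_def subset_iff)
  qed
  then show thesis
    using that \<F> by blast
qed

section \<open>Congruence and products\<close>

lemma euclid_dist_self [simp]: "euclid_dist x x = 0"
  by (simp add: euclid_dist_def L2_set_def)

lemma euclid_dist_nonneg [simp]: "0 \<le> euclid_dist x y"
  by (simp add: euclid_dist_def)

lemma euclid_dist_append: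
  assumes "length x = length x'"
  shows "euclid_dist (x @ y) (x' @ y') = sqrt ((euclid_dist x x')\<^sup>2 + (euclid_dist y y')\<^sup>2)"
proof -
  have "sum f {..<length x + n} = sum f {..<length x} + (\<Sum>i<n. f (length x + i))"
    for f :: "nat \<Rightarrow> real" and n
    by (induction n) (simp_all add: add.assoc)
  then show ?thesis
    using assms by (simp add: euclid_dist_def L2_set_def nth_append sum_nonneg)
qed

definition isometric_on :: "(real list \<Rightarrow> real list) \<Rightarrow> real list set \<Rightarrow> bool" where
  "isometric_on f K \<longleftrightarrow> (\<forall>x\<in>K. \<forall>y\<in>K. euclid_dist (f x) (f y) = euclid_dist x y)"

lemma congruent_confI: "bij_betw f K L \<Longrightarrow> isometric_on f K \<Longrightarrow> congruent_conf K L"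
  unfolding congruent_conf_def isometric_on_def by blast

lemma congruent_confE:
  assumes "congruent_conf K L"
  obtains f where "bij_betw f K L" "isometric_on f K"
  using assms unfolding congruent_conf_def isometric_on_def by blast

lemma congruent_conf_refl: "congruent_conf K K"
  by (rule congruent_confI[of id]) (simp_all add: isometric_on_def)

lemma congruent_conf_trans:
  assumes "congruent_conf K L" "congruent_conf L M"
  shows "congruent_conf K M"
proof -
  obtain f where f: "bij_betw f K L" "isometric_on f K"
    using assms(1) by (rule congruent_confE)
  obtain g where g: "bij_betw g L M" "isometric_on g L"
    using assms(2) by (rule congruent_confE)
  show ?thesis
  proof (rule congruent_confI)
    show "bij_betw (g \<circ> f) K M"
      using f(1) g(1) by (rule bij_betw_trans)
    show "isometric_on (g \<circ> f) K"
      using f(2) g(2) by (simp add: isometric_on_def bij_betw_apply[OF f(1)])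
  qed
qed

lemma congruent_conf_subset:
  assumes "congruent_conf K L" "K' \<subseteq> K"
  obtains L' where "L' \<subseteq> L" "congruent_conf K' L'"
proof -
  obtain f where f: "bij_betw f K L" "isometric_on f K"
    using assms(1) by (rule congruent_confE)
  have "bij_betw f K' (f ` K')"
    using f(1) assms(2) by (auto intro: bij_betw_subset)
  moreover have "isometric_on f K'"
    using f(2) assms(2) by (auto simp: isometric_on_def)
  ultimately have "congruent_conf K' (f ` K')"
    by (rule congruent_confI)
  moreover have "f ` K' \<subseteq> L"
    using f(1) assms(2) by (auto simp: bij_betw_def)
  ultimately show thesis
    using that by blast
qed

lemma congruent_conf_finite: "congruent_conf K L \<Longrightarrow> finite K \<longleftrightarrow> finite L"
  unfolding congruent_conf_def by (metis bij_betw_finite)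

lemma congruent_conf_card: "congruent_conf K L \<Longrightarrow> card K = card L"
  unfolding congruent_conf_def by (metis bij_betw_same_card)

lemma congruent_conf_empty_iff: "congruent_conf K L \<Longrightarrow> K = {} \<longleftrightarrow> L = {}"
  unfolding congruent_conf_def by (auto simp: bij_betw_def)

lemma cart_prod_eq_image: "cart_prod K L = (\<lambda>(x, y). x @ y) ` (K \<times> L)"
  by (auto simp: cart_prod_def)

lemma cart_prod_mono: "K \<subseteq> K' \<Longrightarrow> L \<subseteq> L' \<Longrightarrow> cart_prod K L \<subseteq> cart_prod K' L'"
  by (auto simp: cart_prod_def)

lemma cart_prod_euclid_subset: "cart_prod (euclid m) (euclid n) \<subseteq> euclid (m + n)"
  by (auto simp: cart_prod_def euclid_def)

lemma card_cart_prod: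
  assumes "K \<subseteq> euclid m"
  shows "card (cart_prod K L) = card K * card L"
proof -
  have "inj_on (\<lambda>(x, y). x @ y) (K \<times> L)"
    using assms by (auto simp: inj_on_def euclid_def subset_iff)
  then show ?thesis
    by (simp add: cart_prod_eq_image card_image card_cartesian_product)
qed

lemma configuration_cart_prod:
  assumes "configuration K" "configuration L"
  shows "configuration (cart_prod K L)"
proof -
  obtain m n where "K \<subseteq> euclid m" "L \<subseteq> euclid n"
    using assms by (auto simp: configuration_def)
  then have "cart_prod K L \<subseteq> euclid (m + n)"
    using cart_prod_mono cart_prod_euclid_subset by (meson order_trans)
  then show ?thesis
    using assms by (auto simp: configuration_def cart_prod_eq_image)
qed

lemma congruent_conf_cart_prod:
  assumes K\<^sub>1: "K\<^sub>1 \<subseteq> euclid m" and L\<^sub>1: "L\<^sub>1 \<subseteq> euclid d"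
    and "congruent_conf K\<^sub>1 L\<^sub>1" "congruent_conf K\<^sub>2 L\<^sub>2"
  shows "congruent_conf (cart_prod K\<^sub>1 K\<^sub>2) (cart_prod L\<^sub>1 L\<^sub>2)"
proof -
  obtain f where f: "bij_betw f K\<^sub>1 L\<^sub>1" "isometric_on f K\<^sub>1"
    using assms(3) by (rule congruent_confE)
  obtain g where g: "bij_betw g K\<^sub>2 L\<^sub>2" "isometric_on g K\<^sub>2"
    using assms(4) by (rule congruent_confE)
  define h where "h z = f (take m z) @ g (drop m z)" for z
  have h_append: "h (x @ y) = f x @ g y" if "x \<in> K\<^sub>1" for x y
    using that K\<^sub>1 by (auto simp: h_def euclid_def)
  have lengths: "length x = m" "length (f x) = d" if "x \<in> K\<^sub>1" for x
    using that f(1) K\<^sub>1 L\<^sub>1 by (auto simp: euclid_def bij_betw_def)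
  show ?thesis
  proof (rule congruent_confI)
    have "inj_on h (cart_prod K\<^sub>1 K\<^sub>2)"
      using f(1) g(1) by (auto simp: inj_on_def cart_prod_def h_append lengths bij_betw_def)
    moreover have "h ` cart_prod K\<^sub>1 K\<^sub>2 = cart_prod (f ` K\<^sub>1) (g ` K\<^sub>2)"
      by (force simp: cart_prod_eq_image h_append)
    ultimately show "bij_betw h (cart_prod K\<^sub>1 K\<^sub>2) (cart_prod L\<^sub>1 L\<^sub>2)"
      using f(1) g(1) by (simp add: bij_betw_def)
    show "isometric_on h (cart_prod K\<^sub>1 K\<^sub>2)"
      using f(2) g(2)
      by (auto simp: isometric_on_def cart_prod_def h_append lengths euclid_dist_append)
  qed
qed

lemma congruent_conf_cart_prod_singleton:
  assumes "K \<subseteq> euclid m"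
  shows "congruent_conf K (cart_prod K {y})"
proof (rule congruent_confI)
  show "bij_betw (\<lambda>x. x @ y) K (cart_prod K {y})"
    by (auto simp: bij_betw_def inj_on_def cart_prod_def)
  show "isometric_on (\<lambda>x. x @ y) K"
    using assms by (auto simp: isometric_on_def euclid_dist_append euclid_def subset_iff)
qed

primrec cart_power :: "real list set \<Rightarrow> nat \<Rightarrow> real list set" where
  "cart_power K 0 = {[]}"
| "cart_power K (Suc n) = cart_prod K (cart_power K n)"

lemma cart_power_1: "cart_power K 1 = K"
  by (simp add: cart_prod_def)

lemma card_cart_power: "K \<subseteq> euclid m \<Longrightarrow> card (cart_power K n) = card K ^ n"
  by (induction n) (simp_all add: card_cart_prod)

section \<open>Monochromatic copies inside a set of points\<close>

text \<open>The relation written \<open>X \<longrightarrow> (K)\<^sub>r\<close> in Euclidean Ramsey theory.\<close>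

definition arrows :: "real list set \<Rightarrow> real list set \<Rightarrow> nat \<Rightarrow> bool" where
  "arrows X K r \<longleftrightarrow> (\<forall>c \<in> X \<rightarrow> {..<r}. \<exists>L\<subseteq>X. congruent_conf K L \<and> monochromatic c L)"

lemma coloring_iff_funcset: "coloring d r c \<longleftrightarrow> c \<in> euclid d \<rightarrow> {..<r}"
  by (auto simp: coloring_def)

lemma monochromatic_iff_constant_on: "monochromatic c K \<longleftrightarrow> c constant_on K"
  unfolding monochromatic_def constant_on_def by metis

lemma rainbow_iff_inj_on: "rainbow c K \<longleftrightarrow> inj_on c K"
  by (auto simp: rainbow_def inj_on_def)

lemma ramsey_iff_arrows:
  "ramsey K \<longleftrightarrow> configuration K \<and> (\<forall>r\<ge>1. \<exists>d. arrows (euclid d) K r)"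
  by (simp add: ramsey_def arrows_def coloring_iff_funcset Ball_def)

lemma arrows_superset:
  assumes "arrows X K r" "X \<subseteq> Y"
  shows "arrows Y K r"
  unfolding arrows_def
proof
  fix c
  assume "c \<in> Y \<rightarrow> {..<r}"
  then have "c \<in> X \<rightarrow> {..<r}"
    using assms(2) by blast
  then show "\<exists>L\<subseteq>Y. congruent_conf K L \<and> monochromatic c L"
    using assms unfolding arrows_def by (meson order_trans)
qed

lemma arrows_congruent_subset:
  assumes "arrows X P r" "congruent_conf K K'" "K' \<subseteq> P"
  shows "arrows X K r"
  unfolding arrows_def
proof
  fix c
  assume "c \<in> X \<rightarrow> {..<r}"
  then obtain L where L: "L \<subseteq> X" "congruent_conf P L" "monochromatic c L"
    using assms(1) unfolding arrows_def by blast
  obtain L' where L': "L' \<subseteq> L" "congruent_conf K' L'"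
    using L(2) assms(3) by (rule congruent_conf_subset)
  moreover have "congruent_conf K L'"
    using assms(2) L'(2) by (rule congruent_conf_trans)
  moreover have "monochromatic c L'"
    using L(3) L'(1) unfolding monochromatic_iff_constant_on by (rule constant_on_subset)
  ultimately show "\<exists>L\<subseteq>X. congruent_conf K L \<and> monochromatic c L"
    using L(1) by blast
qed

lemma arrows_cart_prod_left:
  assumes "arrows X (cart_prod K P) r" "K \<subseteq> euclid m" "P \<noteq> {}"
  shows "arrows X K r"
proof -
  obtain y where "y \<in> P"
    using assms(3) by blast
  then have "cart_prod K {y} \<subseteq> cart_prod K P"
    by (intro cart_prod_mono) auto
  with assms(1) congruent_conf_cart_prod_singleton[OF assms(2)] show ?thesis
    by (rule arrows_congruent_subset)
qed

lemma arrows_finite_range: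
  assumes "arrows X K (card C)" "finite C" "f \<in> X \<rightarrow> C"
  obtains L where "L \<subseteq> X" "congruent_conf K L" "f constant_on L"
proof -
  obtain e where e: "bij_betw e C {..<card C}"
    using ex_bij_betw_finite_nat[OF assms(2)] by (auto simp: atLeast0LessThan)
  have "e \<circ> f \<in> X \<rightarrow> {..<card C}"
    using assms(3) bij_betwE[OF e] by auto
  then obtain L where L: "L \<subseteq> X" "congruent_conf K L" "(e \<circ> f) constant_on L"
    using assms(1) unfolding arrows_def monochromatic_iff_constant_on by blast
  have "inj_on e (f ` L)"
    using e L(1) assms(3) by (auto simp: bij_betw_def intro: inj_on_subset)
  with L(3) have "f constant_on L"
    unfolding constant_on_def comp_def by (metis imageI inj_onD)
  with L(1,2) show thesis
    by (rule that)
qed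

lemma arrows_finite_subset:
  assumes "arrows X K r" "finite K" "1 \<le> r"
  obtains T where "finite T" "T \<subseteq> X" "arrows T K r"
proof -
  define \<E> where "\<E> = {L. L \<subseteq> X \<and> congruent_conf K L}"
  have finite_copies: "\<forall>L\<in>\<E>. finite L"
    using assms(2) by (auto simp: \<E>_def dest: congruent_conf_finite)
  moreover have "\<E> \<subseteq> Pow X"
    by (auto simp: \<E>_def)
  moreover have "\<forall>c \<in> X \<rightarrow> {..<r}. \<exists>L\<in>\<E>. c constant_on L"
    using assms(1) by (auto simp: arrows_def \<E>_def monochromatic_iff_constant_on)
  ultimately obtain \<F> where \<F>: "finite \<F>" "\<F> \<subseteq> \<E>"
      and ex_constant: "\<forall>c \<in> X \<rightarrow> {..<r}. \<exists>L\<in>\<F>. c constant_on L"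
    by (rule finite_subfamily_constant_on[OF finite_lessThan])
  have "arrows (\<Union>\<F>) K r"
    unfolding arrows_def
  proof
    fix c
    assume c: "c \<in> \<Union>\<F> \<rightarrow> {..<r}"
    define c' where "c' x = (if x \<in> \<Union>\<F> then c x else 0)" for x
    have "c' \<in> X \<rightarrow> {..<r}"
      using c assms(3) by (auto simp: c'_def)
    then obtain L where L: "L \<in> \<F>" "c' constant_on L"
      using ex_constant by blast
    have "\<forall>x\<in>L. c' x = c x"
      using L(1) by (auto simp: c'_def)
    then have "monochromatic c L"
      using L(2) by (simp add: monochromatic_iff_constant_on constant_on_def)
    then show "\<exists>L\<subseteq>\<Union>\<F>. congruent_conf K L \<and> monochromatic c L"
      using L(1) \<F>(2) by (auto simp: \<E>_def)
  qed
  moreover have "finite (\<Union>\<F>)"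
    using \<F> finite_copies by blast
  moreover have "\<Union>\<F> \<subseteq> X"
    using \<F>(2) by (auto simp: \<E>_def)
  ultimately show thesis
    using that by blast
qed

lemma constant_on_cart_prod:
  assumes "(\<lambda>x. c (x @ y\<^sub>0)) constant_on K"
    and "\<And>x y. x \<in> K \<Longrightarrow> y \<in> L \<Longrightarrow> c (x @ y) = c (x @ y\<^sub>0)"
  shows "c constant_on cart_prod K L"
  using assms by (auto simp: constant_on_def cart_prod_def)

lemma arrows_cart_prod:
  assumes K\<^sub>1: "K\<^sub>1 \<subseteq> euclid m" and "K\<^sub>2 \<noteq> {}" and T: "finite T" "T \<subseteq> euclid d"
    and arrows\<^sub>1: "arrows T K\<^sub>1 r" and arrows\<^sub>2: "arrows Y K\<^sub>2 (r ^ card T)"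
  shows "arrows (cart_prod T Y) (cart_prod K\<^sub>1 K\<^sub>2) r"
  unfolding arrows_def
proof
  fix c
  assume "c \<in> cart_prod T Y \<rightarrow> {..<r}"
  then have c: "c (x @ y) < r" if "x \<in> T" "y \<in> Y" for x y
    using that by (auto simp: cart_prod_def)
  define t where "t y = restrict (\<lambda>x. c (x @ y)) T" for y
  have "arrows Y K\<^sub>2 (card (T \<rightarrow>\<^sub>E {..<r}))"
    using arrows\<^sub>2 T(1) by (simp add: card_funcsetE)
  moreover have "finite (T \<rightarrow>\<^sub>E {..<r})"
    using T(1) by (simp add: finite_PiE)
  moreover have "t \<in> Y \<rightarrow> (T \<rightarrow>\<^sub>E {..<r})"
    using c by (auto simp: t_def)
  ultimately obtain L\<^sub>2 where L\<^sub>2: "L\<^sub>2 \<subseteq> Y" "congruent_conf K\<^sub>2 L\<^sub>2" "t constant_on L\<^sub>2"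
    by (rule arrows_finite_range)
  obtain y\<^sub>0 where y\<^sub>0: "y\<^sub>0 \<in> L\<^sub>2"
    using congruent_conf_empty_iff[OF L\<^sub>2(2)] \<open>K\<^sub>2 \<noteq> {}\<close> by blast
  have c_eq: "c (x @ y) = c (x @ y\<^sub>0)" if "x \<in> T" "y \<in> L\<^sub>2" for x y
  proof -
    have "t y x = t y\<^sub>0 x"
      using L\<^sub>2(3) that(2) y\<^sub>0 by (auto simp: constant_on_def)
    then show ?thesis
      using that(1) by (simp add: t_def)
  qed
  have "(\<lambda>x. c (x @ y\<^sub>0)) \<in> T \<rightarrow> {..<r}"
    using c y\<^sub>0 L\<^sub>2(1) by auto
  then obtain L\<^sub>1 where L\<^sub>1: "L\<^sub>1 \<subseteq> T" "congruent_conf K\<^sub>1 L\<^sub>1" "(\<lambda>x. c (x @ y\<^sub>0)) constant_on L\<^sub>1"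
    using arrows\<^sub>1 unfolding arrows_def monochromatic_iff_constant_on by blast
  have "cart_prod L\<^sub>1 L\<^sub>2 \<subseteq> cart_prod T Y"
    using L\<^sub>1(1) L\<^sub>2(1) by (rule cart_prod_mono)
  moreover have "congruent_conf (cart_prod K\<^sub>1 K\<^sub>2) (cart_prod L\<^sub>1 L\<^sub>2)"
    using K\<^sub>1 order_trans[OF L\<^sub>1(1) T(2)] L\<^sub>1(2) L\<^sub>2(2) by (rule congruent_conf_cart_prod)
  moreover have "c constant_on cart_prod L\<^sub>1 L\<^sub>2"
    using L\<^sub>1(3) by (rule constant_on_cart_prod) (use c_eq L\<^sub>1(1) in blast)
  ultimately show "\<exists>L\<subseteq>cart_prod T Y. congruent_conf (cart_prod K\<^sub>1 K\<^sub>2) L \<and> monochromatic c L"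
    unfolding monochromatic_iff_constant_on by blast
qed

section \<open>Ramsey and Gallai-Ramsey configurations\<close>

lemma ramsey_imp_gallai_ramsey: "ramsey K \<Longrightarrow> gallai_ramsey K"
  unfolding ramsey_def gallai_ramsey_def by meson

lemma ramsey_singleton: "ramsey {x}"
proof -
  have "arrows (euclid (length x)) {x} r" for r
    unfolding arrows_def
    by (intro ballI exI[of _ "{x}"]) (simp add: congruent_conf_refl monochromatic_def euclid_def)
  moreover have "configuration {x}"
    by (auto simp: configuration_def euclid_def)
  ultimately show ?thesis
    unfolding ramsey_iff_arrows by blast
qed

lemma ramsey_cart_prod:
  assumes K\<^sub>1: "ramsey K\<^sub>1" and K\<^sub>2: "ramsey K\<^sub>2"
  shows "ramsey (cart_prod K\<^sub>1 K\<^sub>2)"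
  unfolding ramsey_iff_arrows
proof (intro conjI allI impI)
  have conf: "configuration K\<^sub>1" "configuration K\<^sub>2"
    using K\<^sub>1 K\<^sub>2 by (auto simp: ramsey_iff_arrows)
  then show "configuration (cart_prod K\<^sub>1 K\<^sub>2)"
    by (rule configuration_cart_prod)
  obtain m where m: "K\<^sub>1 \<subseteq> euclid m" and fin: "finite K\<^sub>1" and nonempty: "K\<^sub>2 \<noteq> {}"
    using conf by (auto simp: configuration_def)
  fix r :: nat
  assume r: "1 \<le> r"
  obtain d\<^sub>1 where "arrows (euclid d\<^sub>1) K\<^sub>1 r"
    using K\<^sub>1 r by (auto simp: ramsey_iff_arrows)
  then obtain T where T: "finite T" "T \<subseteq> euclid d\<^sub>1" "arrows T K\<^sub>1 r"
    using fin r by (rule arrows_finite_subset)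
  have "1 \<le> r ^ card T"
    using r by simp
  then obtain d\<^sub>2 where "arrows (euclid d\<^sub>2) K\<^sub>2 (r ^ card T)"
    using K\<^sub>2 unfolding ramsey_iff_arrows by blast
  with m nonempty T have "arrows (cart_prod T (euclid d\<^sub>2)) (cart_prod K\<^sub>1 K\<^sub>2) r"
    by (rule arrows_cart_prod)
  moreover have "cart_prod T (euclid d\<^sub>2) \<subseteq> euclid (d\<^sub>1 + d\<^sub>2)"
    using cart_prod_mono[OF T(2) order_refl] cart_prod_euclid_subset by (rule order_trans)
  ultimately show "\<exists>d. arrows (euclid d) (cart_prod K\<^sub>1 K\<^sub>2) r"
    using arrows_superset by blast
qed

lemma card_le_if_rainbow:
  assumes "rainbow c L" "c \<in> L \<rightarrow> {..<r}"
  shows "card L \<le> r"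
  using card_inj_on_le[of c L "{..<r}"] assms by (auto simp: rainbow_iff_inj_on)

lemma gallai_ramsey_imp_arrows:
  assumes "gallai_ramsey K" "1 \<le> r" "r < card K"
  obtains d where "arrows (euclid d) K r"
proof -
  obtain d where d: "\<And>c. coloring d r c \<Longrightarrow>
      \<exists>L\<subseteq>euclid d. congruent_conf K L \<and> (monochromatic c L \<or> rainbow c L)"
    using assms(1,2) unfolding gallai_ramsey_def by meson
  have "arrows (euclid d) K r"
    unfolding arrows_def
  proof
    fix c
    assume c: "c \<in> euclid d \<rightarrow> {..<r}"
    then obtain L where L: "L \<subseteq> euclid d" "congruent_conf K L" "monochromatic c L \<or> rainbow c L"
      using d[of c] by (auto simp: coloring_iff_funcset)
    have "\<not> card L \<le> r"
      using congruent_conf_card[OF L(2)] assms(3) by simp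
    then have "\<not> rainbow c L"
      using card_le_if_rainbow[of c L r] c L(1) by blast
    with L show "\<exists>L\<subseteq>euclid d. congruent_conf K L \<and> monochromatic c L"
      by blast
  qed
  then show thesis
    by (rule that)
qed

lemma gallai_ramsey_cart_power:
  assumes "\<And>L. gallai_ramsey L \<Longrightarrow> gallai_ramsey (cart_prod K L)"
  shows "gallai_ramsey (cart_power K n)"
  by (induction n) (simp_all add: assms ramsey_singleton ramsey_imp_gallai_ramsey)

lemma ramsey_if_gallai_ramsey_cart_power:
  assumes power: "\<And>n. gallai_ramsey (cart_power K n)"
  shows "ramsey K"
proof (cases "card K = 1")
  case True
  then show ?thesis
    by (auto simp: card_1_singleton_iff ramsey_singleton)
next
  case False
  have conf: "configuration (cart_power K n)" for n
    using power by (simp add: gallai_ramsey_def)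
  have "configuration K"
    using conf[of 1] by (simp only: cart_power_1)
  then obtain m where K: "K \<subseteq> euclid m" "finite K" "K \<noteq> {}"
    by (auto simp: configuration_def)
  with False have "2 \<le> card K"
    by (metis One_nat_def Suc_1 Suc_leI card_gt_0_iff le_neq_implies_less)
  have "\<exists>d. arrows (euclid d) K r" if "1 \<le> r" for r
  proof -
    have "r < 2 ^ Suc r"
      using less_exp[of "Suc r"] by (rule Suc_lessD)
    also have "\<dots> \<le> card K ^ Suc r"
      using \<open>2 \<le> card K\<close> by (rule power_mono) simp
    also have "\<dots> = card (cart_power K (Suc r))"
      using K(1) by (rule card_cart_power[symmetric])
    finally have "r < card (cart_power K (Suc r))" .
    with power that obtain d where "arrows (euclid d) (cart_power K (Suc r)) r"
      by (rule gallai_ramsey_imp_arrows)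
    moreover have "cart_power K r \<noteq> {}"
      using conf[of r] by (simp add: configuration_def)
    ultimately have "arrows (euclid d) K r"
      using K(1) by (auto intro: arrows_cart_prod_left)
    then show ?thesis ..
  qed
  then show ?thesis
    using \<open>configuration K\<close> by (simp add: ramsey_iff_arrows)
qed

theorem theorem8:
  "(\<forall>K\<^sub>1 K\<^sub>2. gallai_ramsey K\<^sub>1 \<and> gallai_ramsey K\<^sub>2 \<longrightarrow> gallai_ramsey (cart_prod K\<^sub>1 K\<^sub>2))
   \<longleftrightarrow> (\<forall>K. gallai_ramsey K \<longrightarrow> ramsey K)"
proof (intro iffI allI impI)
  fix K
  assume "\<forall>K\<^sub>1 K\<^sub>2. gallai_ramsey K\<^sub>1 \<and> gallai_ramsey K\<^sub>2 \<longrightarrow> gallai_ramsey (cart_prod K\<^sub>1 K\<^sub>2)"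
    and "gallai_ramsey K"
  then have "gallai_ramsey (cart_power K n)" for n
    by (intro gallai_ramsey_cart_power) simp
  then show "ramsey K"
    by (rule ramsey_if_gallai_ramsey_cart_power)
next
  fix K\<^sub>1 K\<^sub>2
  assume "\<forall>K. gallai_ramsey K \<longrightarrow> ramsey K" and "gallai_ramsey K\<^sub>1 \<and> gallai_ramsey K\<^sub>2"
  then have "ramsey (cart_prod K\<^sub>1 K\<^sub>2)"
    by (intro ramsey_cart_prod) simp_all
  then show "gallai_ramsey (cart_prod K\<^sub>1 K\<^sub>2)"
    by (rule ramsey_imp_gallai_ramsey)
qed

end
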